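(* Let $\lambda\in \mathbb{K}^*$. The polynomial $f= x(x-y^2)^2-2\lambda y(x-y^2)+\lambda^2\in\mathbb{K}[x,y]$ is minimal but is not $G$-equivalent to a monic polynomial.
   Context: $\mathbb{K}$ is an algebraically closed field of characteristic zero. For $f\in\mathbb{K}[x,y]$ put $d_y=\deg_y f$ and let $\Delta_y(f)\in\mathbb{K}[x]$ be its discriminant with respect to $y$. A polynomial $f$ is minimal if it is irreducible and $\deg_x\Delta_y(f)=d_y-1$. It is monic if its leading coefficient with respect to $y$ is a nonzero constant. Let $G=GL_2(\mathbb{K}[x])$. It acts on irreducible polynomials $f$ with $d_y>1$ by \[ \begin{pmatrix} a & b \\ c & d \end{pmatrix}(f)=(cy+d)^{d_y} f\Big(x,\frac{ay+b}{cy+d}\Big). \] Two such irreducible polynomials $f,g$ (of $y$-degree $>1$) are $G$-equivalent, written $f\equiv g$, if $f=\sigma(g)$ for some $\sigma\in G$. *)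

theory Defs
  imports
    "Subresultants.Resultant_Prelim"
    "HOL-Computational_Algebra.Polynomial_Factorial"
begin

text \<open>
  The ring \<open>K[x,y]\<close> is rendered as \<open>K[x][y]\<close>, the type \<open>'a poly poly\<close>: the outer
  variable is \<open>y\<close>, so \<open>degree\<close> and \<open>lead_coeff\<close> of an \<open>'a poly poly\<close> refer to \<open>y\<close>.
\<close>

definition Xvar :: "'a::field poly poly"
  where "Xvar = [:[:0, 1:]:]"

definition Yvar :: "'a::field poly poly"
  where "Yvar = [:0, 1:]"

definition Const :: "'a::field \<Rightarrow> 'a poly poly"
  where "Const c = [:[:c:]:]"

text \<open>
  The discriminant in the normalisation \<open>(-1)^(n(n-1)/2) Res(f, f') / lc(f)\<close>, where \<open>n\<close> is the
  degree of \<open>f\<close>. The division by the leading coefficient matters for non-monic \<open>f\<close>;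
  it is exact for \<open>n > 0\<close> (lemma \<open>discriminant_exact\<close>). For \<open>n = 0\<close> the value is meaningless.
\<close>

definition discriminant :: "'a::idom_divide poly \<Rightarrow> 'a"
  where "discriminant f =
    ((-1) ^ (degree f * (degree f - 1) div 2) * resultant f (pderiv f)) div lead_coeff f"

lemma discriminant_exact:
  fixes f :: "'a::{idom_divide, ring_char_0} poly"
  assumes "degree f > 0"
  shows "lead_coeff f * discriminant f =
    (-1) ^ (degree f * (degree f - 1) div 2) * resultant f (pderiv f)"
proof -
  let ?g = "pderiv f"
  let ?N = "degree f + degree ?g"
  let ?S = "sylvester_mat f ?g"
  have dg: "degree ?g = degree f - 1" by (rule degree_pderiv)
  have S: "?S \<in> carrier_mat ?N ?N" by (rule sylvester_carrier_mat)
  have N: "0 < ?N" using assms by simp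
  have lc: "lead_coeff f dvd of_nat k * coeff f k" if "k = degree f" for k
    using that by simp
  have "lead_coeff f dvd ?S $$ (i, 0)" if i: "i < ?N" for i
  proof (cases "i = 0 \<or> Suc i \<noteq> degree f")
    case True
    then show ?thesis
      using i N assms lc[of 1]
      by (auto simp: sylvester_index_mat dg coeff_pderiv Suc_le_eq not_less le_Suc_eq simp del: of_nat_Suc)
  next
    case False
    then show ?thesis
      using i N assms lc[of "Suc i"]
      by (auto simp: sylvester_index_mat dg coeff_pderiv simp del: of_nat_Suc)
  qed
  then have "lead_coeff f dvd det ?S"
    unfolding laplace_expansion_column[OF S N] by (intro dvd_sum) (auto intro: dvd_mult2)
  then show ?thesis
    by (simp add: discriminant_def resultant_def)
qed

text \<open>
  The condition \<open>deg\<^sub>x \<Delta> = d\<^sub>y - 1\<close> is an equation of integers, so that \<open>d\<^sub>y = 0\<close> is not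
  affected by truncated subtraction.
\<close>

definition minimal_polynomial :: "'a::field poly poly \<Rightarrow> bool"
  where "minimal_polynomial f \<longleftrightarrow>
    irreducible f \<and> int (degree (discriminant f)) = int (degree f) - 1"

definition monic_in_y :: "'a::field poly poly \<Rightarrow> bool"
  where "monic_in_y f \<longleftrightarrow> (\<exists>c. c \<noteq> 0 \<and> lead_coeff f = [:c:])"

definition GL2 :: "'a::comm_ring_1 mat set"
  where "GL2 = {A \<in> carrier_mat 2 2. invertible_mat A}"

text \<open>
  For \<open>A\<close> with rows \<open>(a, b)\<close> and \<open>(c, d)\<close> this is \<open>(cy + d)\<^sup>n f(x, (ay + b) / (cy + d))\<close> with
  \<open>n = degree f\<close> and denominators cleared; see lemma \<open>to_fract_GL2_act\<close>.
\<close>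

definition GL2_act :: "'a::field poly mat \<Rightarrow> 'a poly poly \<Rightarrow> 'a poly poly"
  where "GL2_act A f = (\<Sum>i\<le>degree f.
    [:coeff f i:] * [:A $$ (0,1), A $$ (0,0):] ^ i * [:A $$ (1,1), A $$ (1,0):] ^ (degree f - i))"

lemma to_fract_GL2_act:
  fixes f :: "'a::field poly poly"
  assumes "[:A $$ (1,1), A $$ (1,0):] \<noteq> 0"
  shows "to_fract (GL2_act A f) =
    to_fract [:A $$ (1,1), A $$ (1,0):] ^ degree f *
    poly (map_poly (\<lambda>p. to_fract [:p:]) f)
      (to_fract [:A $$ (0,1), A $$ (0,0):] / to_fract [:A $$ (1,1), A $$ (1,0):])"
proof -
  let ?u = "[:A $$ (0,1), A $$ (0,0):]" and ?v = "[:A $$ (1,1), A $$ (1,0):]"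
  have pow: "to_fract (p ^ k) = to_fract p ^ k" for p :: "'a poly poly" and k
    by (induction k) auto
  have deg: "degree (map_poly (\<lambda>p. to_fract [:p:]) f) = degree f"
    by (rule degree_map_poly) simp
  have v: "to_fract ?v \<noteq> 0" using assms by simp
  have "to_fract ?u ^ i * to_fract ?v ^ (degree f - i) =
      to_fract ?v ^ degree f * (to_fract ?u / to_fract ?v) ^ i" if "i \<le> degree f" for i
    using v that by (simp add: power_divide power_diff)
  then have "to_fract ([:coeff f i:] * ?u ^ i * ?v ^ (degree f - i)) =
      to_fract ?v ^ degree f * (to_fract [:coeff f i:] * (to_fract ?u / to_fract ?v) ^ i)"
    if "i \<le> degree f" for i
    unfolding to_fract_mult pow using that by (simp only: mult.assoc mult.left_commute)
  then show ?thesis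
    unfolding GL2_act_def poly_altdef deg to_fract_sum sum_distrib_left
    by (intro sum.cong refl) (simp only: coeff_map_poly atMost_iff pCons_0_0 to_fract_0)
qed

definition G_equivalent :: "'a::field poly poly \<Rightarrow> 'a poly poly \<Rightarrow> bool"
  where "G_equivalent f g \<longleftrightarrow>
    irreducible f \<and> degree f > 1 \<and> irreducible g \<and> degree g > 1 \<and>
    (\<exists>\<sigma>\<in>GL2. f = GL2_act \<sigma> g)"

end

theory Submission
  imports Defs
begin

text \<open>
  Write \<open>X = x\<close>, \<open>L = \<lambda>\<close> and \<open>u = x - y\<^sup>2\<close>. Putting \<open>x = u + y\<^sup>2\<close> in
  the definition of \<open>f\<close> gives \<open>f = u\<^sup>3 + (y u - L)\<^sup>2\<close>. The coefficients of \<open>f\<close> in \<open>y\<close>, in ascending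
  order, are \<open>X\<^sup>3 + L\<^sup>2\<close>, \<open>-2 L X\<close>, \<open>-2 X\<^sup>2\<close>, \<open>2 L\<close> and \<open>X\<close>.

  Irreducibility. As a polynomial in \<open>x\<close> over \<open>K[y]\<close>, \<open>f\<close> is a monic cubic, so a proper factorisation
  would produce a root \<open>r \<in> K[y]\<close>. For \<open>u = r - y\<^sup>2\<close> this expression for \<open>f\<close> shows that \<open>u\<close> divides
  the nonzero constant \<open>L\<^sup>2\<close>, so \<open>u\<close> is a nonzero constant; then \<open>u\<^sup>3 + (y u - L)\<^sup>2\<close> has \<open>y\<^sup>2\<close>-coefficient
  \<open>u\<^sup>2 \<noteq> 0\<close>, which is absurd (\<open>irreducible_quartic\<close>).

  Discriminant. The classical formula for quartics (\<open>discriminant_quartic\<close>) gives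
  \<open>\<Delta> = -256 \<lambda>\<^sup>6 x\<^sup>3 - 432 \<lambda>\<^sup>8\<close>, which has degree \<open>3 = 4 - 1\<close>.

  No monic representative. Homogenise a polynomial \<open>g\<close> of \<open>y\<close>-degree \<open>n\<close> to the binary form
  \<open>G(p, q) = \<Sum> g\<^sub>i p\<^sup>i q\<^sup>n\<^sup>-\<^sup>i\<close> over \<open>K[x]\<close>. The action of \<open>GL\<^sub>2(K[x])\<close> is a
  linear substitution in this form, and \<open>G(1, 0)\<close> is the leading coefficient. So if \<open>f\<close> were
  equivalent to a monic polynomial, then the form \<open>F\<close> of \<open>f\<close> would take a nonzero constant value at some
  \<open>p, q \<in> K[x]\<close> (\<open>GL2_act_monic_unit_value\<close>). But with \<open>w = x q\<^sup>2 - p\<^sup>2\<close> one has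
  \<open>F(p, q) = x w\<^sup>2 - 2 \<lambda> p q w + \<lambda>\<^sup>2 q\<^sup>4\<close>. The two terms of \<open>w\<close> have degrees of
  different parity and cannot cancel, so \<open>2 deg p\<close> and \<open>2 deg q\<close> are at most \<open>deg w\<close>; hence \<open>x w\<^sup>2\<close> has
  strictly larger degree than the other two terms, and \<open>F(p, q)\<close> is never a nonzero constant
  (\<open>degree_quartic_form_pos\<close>).
\<close>

section \<open>Determinants of explicit matrices\<close>

text \<open>
  The Laplace expansion along the first column, with a matrix given as the list of its rows and
  \<open>D\<close> computing the minors. The accumulator \<open>pre\<close> holds the tails of the rows already passed;
  subtracting the expansion of the remaining rows produces the alternating signs.
\<close>

primrec expand_col :: "('a::comm_ring_1 list list \<Rightarrow> 'a) \<Rightarrow> 'a list list \<Rightarrow> 'a list list \<Rightarrow> 'a" where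
  "expand_col D pre [] = 0"
| "expand_col D pre (r # rs) = hd r * D (pre @ map tl rs) - expand_col D (pre @ [tl r]) rs"

primrec list_det :: "nat \<Rightarrow> 'a::comm_ring_1 list list \<Rightarrow> 'a" where
  "list_det 0 = (\<lambda>rs. 1)"
| "list_det (Suc n) = expand_col (list_det n) []"

lemma expand_col_eq_sum:
  "expand_col D pre rs =
    (\<Sum>i<length rs. hd (rs ! i) * ((-1) ^ i * D (pre @ map tl (take i rs @ drop (Suc i) rs))))"
proof (induction rs arbitrary: pre)
  case (Cons r rs)
  show ?case
    by (simp add: Cons.IH sum.lessThan_Suc_shift sum_negf[symmetric] del: sum.lessThan_Suc)
qed simp

text \<open>
  The bridge that lets the simplifier evaluate the determinant of a concrete matrix.
\<close>

lemma det_eq_list_det: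
  assumes "length rs = n" "\<And>r. r \<in> set rs \<Longrightarrow> length r = n"
  shows "det (mat n n (\<lambda>(i, j). rs ! i ! j)) = list_det n rs"
  using assms
proof (induction n arbitrary: rs)
  case 0
  then show ?case by simp
next
  case (Suc n)
  let ?A = "mat (Suc n) (Suc n) (\<lambda>(i, j). rs ! i ! j)"
  let ?m = "\<lambda>i. map tl (take i rs @ drop (Suc i) rs)"
  have minor: "det (mat_delete ?A i 0) = list_det n (?m i)" if i: "i < Suc n" for i
  proof -
    have len: "length (?m i) = n"
      using i Suc.prems(1) by simp
    have "mat_delete ?A i 0 = mat n n (\<lambda>(k, j). ?m i ! k ! j)"
    proof (rule eq_matI)
      fix k j assume "k < dim_row (mat n n (\<lambda>(k, j). ?m i ! k ! j))"
        "j < dim_col (mat n n (\<lambda>(k, j). ?m i ! k ! j))"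
      then have kj: "k < n" "j < n" by auto
      have "?m i ! k = tl (rs ! (if k < i then k else Suc k))"
        using kj i Suc.prems(1) by (simp add: nth_append min_def map_append[symmetric] del: map_append)
      moreover have "tl (rs ! k') ! j = rs ! k' ! Suc j" if "k' < Suc n" for k'
        using that kj Suc.prems by (simp add: nth_tl)
      ultimately show "mat_delete ?A i 0 $$ (k, j) = mat n n (\<lambda>(k, j). ?m i ! k ! j) $$ (k, j)"
        using kj i by (auto simp: mat_delete_def)
    qed (simp_all)
    moreover have "length r = n" if "r \<in> set (?m i)" for r
      using that Suc.prems(2) by (auto dest!: in_set_takeD in_set_dropD)
    ultimately show ?thesis
      using Suc.IH[OF len] by simp
  qed
  have head: "?A $$ (i, 0) = hd (rs ! i)" if "i < Suc n" for i
  proof -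
    have "length (rs ! i) = Suc n" using that Suc.prems by simp
    then have "rs ! i \<noteq> []" by auto
    then show ?thesis using that by (simp add: hd_conv_nth)
  qed
  have "det ?A = (\<Sum>i<Suc n. ?A $$ (i, 0) * cofactor ?A i 0)"
    by (rule laplace_expansion_column) auto
  also have "\<dots> = (\<Sum>i<Suc n. hd (rs ! i) * ((-1) ^ i * list_det n (?m i)))"
    by (intro sum.cong refl) (simp only: head minor cofactor_def lessThan_iff add_0_right)
  finally show ?case
    using Suc.prems(1) by (simp only: list_det.simps expand_col_eq_sum append_Nil)
qed

text \<open>
  The next two rules replace the defining equation of \<open>expand_col\<close> in computations. A vanishing entry must
  be recognised before its minor is evaluated: for a sparse matrix this leaves few of the
  factorially many branches. The guard keeps the general rule away from zero entries.
\<close>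

lemma expand_col_0: "expand_col D pre ((0 # r) # rs) = - expand_col D (pre @ [r]) rs"
  by simp

lemma expand_col_nonzero:
  "NO_MATCH 0 x \<Longrightarrow>
    expand_col D pre ((x # r) # rs) = x * D (pre @ map tl rs) - expand_col D (pre @ [r]) rs"
  by simp

section \<open>The discriminant of a quartic\<close>

text \<open>
  The rows are those of the Sylvester matrix of \<open>a y\<^sup>4 + b y\<^sup>3 + c y\<^sup>2 + d y + e\<close> and its derivative. The
  factor \<open>a\<close> is the leading coefficient that the discriminant divides out.
\<close>

lemma list_det_sylvester_quartic:
  fixes a b c d e :: "'a::comm_ring_1"
  shows "list_det 7
      [[a, b, c, d, e, 0, 0], [0, a, b, c, d, e, 0], [0, 0, a, b, c, d, e],
       [4 * a, 3 * b, 2 * c, d, 0, 0, 0], [0, 4 * a, 3 * b, 2 * c, d, 0, 0],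
       [0, 0, 4 * a, 3 * b, 2 * c, d, 0], [0, 0, 0, 4 * a, 3 * b, 2 * c, d]] =
    a * (256 * a^3 * e^3 - 192 * a^2 * b * d * e^2 - 128 * a^2 * c^2 * e^2 + 144 * a^2 * c * d^2 * e
      - 27 * a^2 * d^4 + 144 * a * b^2 * c * e^2 - 6 * a * b^2 * d^2 * e - 80 * a * b * c^2 * d * e
      + 18 * a * b * c * d^3 + 16 * a * c^4 * e - 4 * a * c^3 * d^2 - 27 * b^4 * e^2
      + 18 * b^3 * c * d * e - 4 * b^3 * d^3 - 4 * b^2 * c^3 * e + b^2 * c^2 * d^2)"
proof -
  \<comment> \<open>The recursion of \<open>list_det\<close> consumes successors.\<close>
  have seven: "7 = Suc (Suc (Suc (Suc (Suc (Suc (Suc 0))))))"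
    by simp
  \<comment> \<open>Cancellation rules would split the equation into the cases \<open>a = 0\<close> and \<open>a \<noteq> 0\<close> before both sides are
    expanded.\<close>
  show ?thesis
    unfolding seven
    by (simp add: expand_col_nonzero expand_col_0
        del: expand_col.simps(2) mult_eq_0_iff mult_cancel_left)
      (simp add: algebra_simps power_numeral_reduce)
qed

lemma discriminant_quartic:
  fixes a b c d e :: "'a::{idom_divide, ring_char_0}"
  assumes "a \<noteq> 0"
  shows "discriminant [:e, d, c, b, a:] =
    256 * a^3 * e^3 - 192 * a^2 * b * d * e^2 - 128 * a^2 * c^2 * e^2 + 144 * a^2 * c * d^2 * e
      - 27 * a^2 * d^4 + 144 * a * b^2 * c * e^2 - 6 * a * b^2 * d^2 * e - 80 * a * b * c^2 * d * e
      + 18 * a * b * c * d^3 + 16 * a * c^4 * e - 4 * a * c^3 * d^2 - 27 * b^4 * e^2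
      + 18 * b^3 * c * d * e - 4 * b^3 * d^3 - 4 * b^2 * c^3 * e + b^2 * c^2 * d^2"
proof -
  let ?f = "[:e, d, c, b, a:]" and ?g = "[:d, 2 * c, 3 * b, 4 * a:]"
  let ?rs = "[[a, b, c, d, e, 0, 0], [0, a, b, c, d, e, 0], [0, 0, a, b, c, d, e],
    [4 * a, 3 * b, 2 * c, d, 0, 0, 0], [0, 4 * a, 3 * b, 2 * c, d, 0, 0],
    [0, 0, 4 * a, 3 * b, 2 * c, d, 0], [0, 0, 0, 4 * a, 3 * b, 2 * c, d]]"
  have g: "pderiv ?f = ?g"
    by (simp add: pderiv_pCons)
  have deg: "degree ?f = 4" "degree ?g = 3"
    using assms by simp_all
  have syl: "sylvester_mat ?f ?g = mat 7 7 (\<lambda>(i, j). ?rs ! i ! j)"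
  proof (rule eq_matI)
    fix i j
    assume ij: "i < dim_row (mat 7 7 (\<lambda>(i, j). ?rs ! i ! j))"
      "j < dim_col (mat 7 7 (\<lambda>(i, j). ?rs ! i ! j))"
    then have "i \<in> {0, 1, 2, 3, 4, 5, 6}" "j \<in> {0, 1, 2, 3, 4, 5, 6}"
      by auto
    then show "sylvester_mat ?f ?g $$ (i, j) = mat 7 7 (\<lambda>(i, j). ?rs ! i ! j) $$ (i, j)"
      unfolding sylvester_mat_def sylvester_mat_sub_def deg
      by (elim insertE emptyE; simp add: numeral_eq_Suc)
  qed (use assms in \<open>simp_all add: sylvester_mat_def sylvester_mat_sub_def deg\<close>)
  have res: "resultant ?f (pderiv ?f) =
    a * (256 * a^3 * e^3 - 192 * a^2 * b * d * e^2 - 128 * a^2 * c^2 * e^2 + 144 * a^2 * c * d^2 * e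
      - 27 * a^2 * d^4 + 144 * a * b^2 * c * e^2 - 6 * a * b^2 * d^2 * e - 80 * a * b * c^2 * d * e
      + 18 * a * b * c * d^3 + 16 * a * c^4 * e - 4 * a * c^3 * d^2 - 27 * b^4 * e^2
      + 18 * b^3 * c * d * e - 4 * b^3 * d^3 - 4 * b^2 * c^3 * e + b^2 * c^2 * d^2)"
    unfolding g resultant_def syl list_det_sylvester_quartic[symmetric]
    by (rule det_eq_list_det) auto
  have "lead_coeff ?f = a" "(-1 :: 'a) ^ (degree ?f * (degree ?f - 1) div 2) = 1"
    using assms by simp_all
  then show ?thesis
    unfolding discriminant_def res
    by (simp only: mult_1_left) (rule nonzero_mult_div_cancel_left[OF assms])
qed

section \<open>Irreducibility and the exchange of the two variables\<close>

text \<open>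
  A proper factorisation contains a linear factor, because a factor of degree zero divides the leading
  coefficient and is a unit; for the same reason the linear factor has a unit leading
  coefficient and hence a root in the ring itself.
\<close>

lemma irreducible_monic_cubic:
  fixes p :: "'a::idom poly"
  assumes "lead_coeff p = 1" "degree p = 3" "\<And>r. poly p r \<noteq> 0"
  shows "irreducible p"
proof (rule irreducibleI)
  show "p \<noteq> 0" using assms(1) by auto
  show "\<not> p dvd 1"
  proof
    assume "p dvd 1"
    then obtain c where "p = [:c:]" by (auto simp: is_unit_poly_iff)
    then show False using assms(2) by simp
  qed
  fix g h assume p: "p = g * h"
  have nz: "g \<noteq> 0" "h \<noteq> 0" using \<open>p \<noteq> 0\<close> p by auto
  have lc: "lead_coeff g * lead_coeff h = 1"
    using assms(1) p by (simp add: lead_coeff_mult)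
  then have lcs: "lead_coeff g dvd 1" "lead_coeff h dvd 1"
    by (metis dvd_triv_left, metis dvd_triv_right)
  have const_unit: "k dvd 1" if "degree k = 0" "lead_coeff k dvd 1" for k :: "'a poly"
    using that by (auto simp: is_unit_poly_iff elim!: degree_eq_zeroE)
  have linear_root: "\<exists>r. poly k r = 0" if k: "degree k = 1" "lead_coeff k dvd 1" for k :: "'a poly"
  proof -
    obtain a b where ab: "k = [:a, b:]" "b \<noteq> 0"
      using k(1) by (rule degree1_coeffs)
    then obtain b' where bb: "b * b' = 1" using k(2) by (auto elim!: dvdE)
    have "poly k (- a * b') = a - a * (b * b')"
      using ab(1) by (simp add: mult_ac)
    then have "poly k (- a * b') = 0"
      using bb by simp
    then show ?thesis by blast
  qed
  have "degree g + degree h = 3"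
    using assms(2) p nz by (simp add: degree_mult_eq)
  moreover have "degree g \<noteq> 1" "degree h \<noteq> 1"
    using linear_root[of g] linear_root[of h] lcs assms(3) p by auto
  ultimately have "degree g = 0 \<or> degree h = 0" by linarith
  then show "g dvd 1 \<or> h dvd 1"
    using const_unit lcs by blast
qed

text \<open>
  Constants embed into polynomials by a ring homomorphism; lifting it once to coefficients, and once
  more to coefficients of coefficients, makes the exchange of variables below a homomorphism
  as well.
\<close>

lemma map_poly_pCons_fix_0: "f 0 = 0 \<Longrightarrow> map_poly f (pCons c p) = pCons (f c) (map_poly f p)"
  by (cases "c = 0 \<and> p = 0") auto

interpretation const_poly_hom: comm_ring_hom "\<lambda>c::'a::comm_ring_1. [:c:]"
  by unfold_locales (simp_all add: one_pCons)

interpretation lift_coeffs_hom: map_poly_comm_ring_hom "\<lambda>c::'a::comm_ring_1. [:c:]" ..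

interpretation lift_coeffs2_hom: map_poly_comm_ring_hom "map_poly (\<lambda>c::'a::comm_ring_1. [:c:])" ..

text \<open>
  The isomorphism \<open>K[x][y] \<rightarrow> K[y][x]\<close>: the coefficients in \<open>x\<close> are moved to the outer variable, and then
  the outer variable is evaluated at the inner one.
\<close>

definition swap_vars :: "'a::comm_ring_1 poly poly \<Rightarrow> 'a poly poly"
  where "swap_vars p = poly (map_poly (map_poly (\<lambda>c. [:c:])) p) [:[:0, 1:]:]"

lemma swap_vars_0 [simp]: "swap_vars 0 = 0"
  by (simp add: swap_vars_def)

lemma swap_vars_1 [simp]: "swap_vars 1 = 1"
  by (simp add: swap_vars_def)

lemma swap_vars_add: "swap_vars (p + q) = swap_vars p + swap_vars q"
  by (simp add: swap_vars_def lift_coeffs2_hom.hom_add)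

lemma swap_vars_mult: "swap_vars (p * q) = swap_vars p * swap_vars q"
  by (simp add: swap_vars_def lift_coeffs2_hom.hom_mult)

lemma swap_vars_pCons:
  "swap_vars (pCons a p) = map_poly (\<lambda>c. [:c:]) a + [:[:0, 1:]:] * swap_vars p"
  by (simp add: swap_vars_def map_poly_pCons_fix_0)

lemma swap_vars_lift: "swap_vars (map_poly (\<lambda>c. [:c:]) a) = [:a:]"
proof (induction a)
  case (pCons c a)
  then show ?case
    by (simp add: swap_vars_pCons map_poly_pCons_fix_0)
qed simp

lemma swap_vars_swap_vars [simp]: "swap_vars (swap_vars p) = p"
proof (induction p)
  case (pCons a p)
  then show ?case
    by (simp only: swap_vars_pCons[of a p] swap_vars_add swap_vars_mult swap_vars_lift pCons.IH)
      (simp add: swap_vars_pCons map_poly_pCons_fix_0)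
qed simp

text \<open>
  Being a multiplicative involution, the exchange of variables preserves and reflects units, and
  irreducibility can be tested on the other side.
\<close>

lemma is_unit_swap_vars_iff: "swap_vars p dvd 1 \<longleftrightarrow> p dvd 1"
proof -
  have "swap_vars p dvd 1" if "p dvd 1" for p :: "'a poly poly"
    using that by (metis dvd_def swap_vars_1 swap_vars_mult)
  from this[of p] this[of "swap_vars p"] show ?thesis by auto
qed

lemma irreducible_of_swap_vars:
  fixes p :: "'a::idom poly poly"
  assumes "irreducible (swap_vars p)"
  shows "irreducible p"
proof (rule irreducibleI)
  show "p \<noteq> 0" using assms by auto
  show "\<not> p dvd 1"
    using assms is_unit_swap_vars_iff[of p] irreducible_not_unit by blast
  fix g h assume "p = g * h"
  then have "swap_vars g dvd 1 \<or> swap_vars h dvd 1"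
    using assms irreducibleD swap_vars_mult by blast
  then show "g dvd 1 \<or> h dvd 1"
    by (simp only: is_unit_swap_vars_iff)
qed

lemma irreducible_quartic:
  fixes lam :: "'a::field"
  assumes "lam \<noteq> 0"
  shows "irreducible [:[:0, 1:] ^ 3 + [:lam:]\<^sup>2, - 2 * [:lam:] * [:0, 1:], - 2 * [:0, 1:]\<^sup>2,
    2 * [:lam:], [:0, 1:]:]"
    (is "irreducible ?f")
proof (rule irreducible_of_swap_vars)
  define Y L :: "'a poly" where "Y = [:0, 1:]" and "L = [:lam:]"
  let ?F = "[:2 * L * Y ^ 3 + L\<^sup>2, Y ^ 4 - 2 * L * Y, - 2 * Y\<^sup>2, 1:]"
  let ?lift = "map_poly (\<lambda>c. [:c:]) :: 'a poly \<Rightarrow> 'a poly poly"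
  have lift: "?lift Y = [:0, 1:]" "?lift [:lam:] = [:L:]" "?lift 2 = 2"
    by (simp_all add: map_poly_pCons_fix_0 Y_def L_def lift_coeffs_hom.hom_numeral)
  have "swap_vars ?f =
      [:0, 1:] ^ 3 + [:L:]\<^sup>2 + [:Y:] * (- 2 * [:L:] * [:0, 1:] + [:Y:] * (- 2 * [:0, 1:]\<^sup>2 +
        [:Y:] * (2 * [:L:] + [:Y:] * [:0, 1:])))"
    by (simp only: swap_vars_pCons swap_vars_0 lift lift_coeffs_hom.hom_add lift_coeffs_hom.hom_mult
        lift_coeffs_hom.hom_power lift_coeffs_hom.hom_uminus Y_def[symmetric] mult_zero_right add_0_right)
  also have "\<dots> = ?F"
    by (simp add: numeral_poly eval_nat_numeral algebra_simps)
  finally have F: "swap_vars ?f = ?F" .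
  have "poly ?F r \<noteq> 0" for r
  proof
    assume r: "poly ?F r = 0"
    define u where "u = r - Y\<^sup>2"
    \<comment> \<open>This is \<open>f = u\<^sup>3 + (y u - \<lambda>)\<^sup>2\<close> at \<open>x = r\<close>.\<close>
    have eq: "u ^ 3 + (Y * u - L)\<^sup>2 = 0"
      using r unfolding u_def by (simp add: algebra_simps power_numeral_reduce)
    have "u * (u\<^sup>2 + Y\<^sup>2 * u - 2 * Y * L) = - (L\<^sup>2)"
      using eq by (simp add: algebra_simps power_numeral_reduce eq_neg_iff_add_eq_0)
    then have "u dvd L\<^sup>2" by (metis dvd_minus_iff dvd_triv_left)
    moreover have "L\<^sup>2 dvd 1"
      using assms by (simp add: L_def is_unit_const_poly_iff power2_eq_square)
    \<comment> \<open>Then \<open>u\<close> is a constant \<open>k\<close>, and the leading coefficient in \<open>y\<close> of the equation is \<open>k\<^sup>2\<close>.\<close>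
    ultimately have "u dvd 1" by (rule dvd_trans)
    then have "u \<noteq> 0" "degree u = 0"
      by auto
    then obtain k where k: "u = [:k:]" "k \<noteq> 0"
      by (auto elim: degree_eq_zeroE)
    then show False
      using eq by (simp add: Y_def L_def power2_eq_square power3_eq_cube)
  qed
  then show "irreducible (swap_vars ?f)"
    unfolding F by (intro irreducible_monic_cubic) simp_all
qed

section \<open>Binary forms and the action of \<open>GL\<^sub>2\<close>\<close>

text \<open>
  The value at \<open>(p, q)\<close> of the homogenisation of \<open>f\<close> in degree \<open>n\<close>. The degree is a parameter
  since the degree of \<open>f = GL2_act A g\<close> could a priori be smaller than that of \<open>g\<close>.
\<close>

definition hom_eval :: "nat \<Rightarrow> 'a::comm_ring_1 poly \<Rightarrow> 'a \<Rightarrow> 'a \<Rightarrow> 'a"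
  where "hom_eval n f p q = (\<Sum>i\<le>n. coeff f i * p ^ i * q ^ (n - i))"

lemma hom_eval_smult: "hom_eval n (smult c f) p q = c * hom_eval n f p q"
  by (simp add: hom_eval_def sum_distrib_left mult.assoc)

lemma hom_eval_add: "hom_eval n (f + g) p q = hom_eval n f p q + hom_eval n g p q"
  by (simp add: hom_eval_def sum.distrib algebra_simps)

lemma hom_eval_sum: "hom_eval n (\<Sum>i\<in>I. f i) p q = (\<Sum>i\<in>I. hom_eval n (f i) p q)"
  by (induction I rule: infinite_finite_induct) (simp_all add: hom_eval_add, simp_all add: hom_eval_def)

lemma hom_eval_Suc:
  assumes "degree f \<le> n"
  shows "hom_eval (Suc n) f p q = q * hom_eval n f p q"
  using assms
  by (simp add: hom_eval_def coeff_eq_0 Suc_diff_le sum_distrib_left algebra_simps)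

lemma hom_eval_pCons_0: "hom_eval (Suc n) (pCons 0 f) p q = p * hom_eval n f p q"
  unfolding hom_eval_def sum.atMost_Suc_shift
  by (simp add: sum_distrib_left mult_ac)

lemma hom_eval_linear_mult:
  assumes "degree f \<le> n"
  shows "hom_eval (Suc n) ([:b, a:] * f) p q = (a * p + b * q) * hom_eval n f p q"
proof -
  have "[:b, a:] * f = smult b f + pCons 0 (smult a f)"
    by simp
  then show ?thesis
    by (simp only: hom_eval_add hom_eval_smult hom_eval_pCons_0 hom_eval_Suc[OF assms])
      (simp add: algebra_simps)
qed

lemma hom_eval_linear_power_mult:
  assumes "degree f \<le> n"
  shows "hom_eval (n + k) ([:b, a:] ^ k * f) p q = (a * p + b * q) ^ k * hom_eval n f p q"
    and "degree ([:b, a:] ^ k * f) \<le> n + k"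
proof (induction k)
  case (Suc k)
  {
    case 1
    show ?case
      using Suc hom_eval_linear_mult[OF Suc.IH(2), of b a p q] by (simp add: mult_ac)
  next
    case 2
    have "degree ([:b, a:] * ([:b, a:] ^ k * f)) \<le> 1 + (n + k)"
      by (rule order_trans[OF degree_mult_le]) (use Suc in \<open>auto intro!: add_mono\<close>)
    then show ?case by (simp add: mult_ac)
  }
qed (use assms in simp_all)

text \<open>
  A summand of the action is a product of \<open>n\<close> linear forms, and homogenisation is multiplicative.
\<close>

lemma GL2_act_summand:
  fixes g :: "'a::field poly poly" and a b c d :: "'a poly"
  assumes "i \<le> n"
  defines "t \<equiv> [:coeff g i:] * [:b, a:] ^ i * [:d, c:] ^ (n - i)"
  shows "hom_eval n t p q = coeff g i * (a * p + b * q) ^ i * (c * p + d * q) ^ (n - i)"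
    and "degree t \<le> n"
proof -
  let ?r = "[:d, c:] ^ (n - i) * [:coeff g i:]"
  have t: "t = [:b, a:] ^ i * ?r"
    by (simp add: t_def mult_ac)
  have r: "hom_eval (n - i) ?r p q = (c * p + d * q) ^ (n - i) * coeff g i"
    "degree ?r \<le> n - i"
    using hom_eval_linear_power_mult(1)[of "[:coeff g i:]" 0 "n - i" d c p q]
      hom_eval_linear_power_mult(2)[of "[:coeff g i:]" 0 d c "n - i"]
    by (simp_all add: hom_eval_def)
  show "hom_eval n t p q = coeff g i * (a * p + b * q) ^ i * (c * p + d * q) ^ (n - i)"
    using hom_eval_linear_power_mult(1)[OF r(2), of i b a p q] assms(1)
    by (simp only: t r(1)) (simp add: mult_ac)
  show "degree t \<le> n"
    using hom_eval_linear_power_mult(2)[OF r(2), of b a i] assms(1)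
    by (simp only: t le_add_diff_inverse2)
qed

lemma degree_GL2_act_le: "degree (GL2_act A g) \<le> degree g"
  unfolding GL2_act_def by (intro degree_sum_le GL2_act_summand(2)) simp_all

text \<open>
  After homogenisation the action is the substitution of \<open>A (p, q)\<close> for \<open>(p, q)\<close>, with no
  denominators left.
\<close>

lemma hom_eval_GL2_act:
  "hom_eval (degree g) (GL2_act A g) p q =
    hom_eval (degree g) g (A $$ (0,0) * p + A $$ (0,1) * q) (A $$ (1,0) * p + A $$ (1,1) * q)"
  unfolding GL2_act_def hom_eval_sum
  unfolding hom_eval_def[of _ g]
  by (intro sum.cong refl GL2_act_summand(1)) simp

text \<open>
  Multiplicativity of the determinant, written out for the four entries of \<open>A B = 1\<close>.
\<close>

lemma GL2_det_unit:
  fixes A :: "'a::comm_ring_1 mat"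
  assumes "A \<in> GL2"
  shows "(A $$ (0,0) * A $$ (1,1) - A $$ (0,1) * A $$ (1,0)) dvd 1"
proof -
  obtain B where A: "A \<in> carrier_mat 2 2" and AB: "A * B = 1\<^sub>m 2" and BA: "B * A = 1\<^sub>m (dim_row B)"
    using assms by (auto simp: GL2_def invertible_mat_def inverts_mat_def)
  have B: "B \<in> carrier_mat 2 2"
    using A arg_cong[OF AB, of dim_col] arg_cong[OF BA, of dim_col] by auto
  have "(A * B) $$ (i, j) = A $$ (i,0) * B $$ (0,j) + A $$ (i,1) * B $$ (1,j)"
    if "i < 2" "j < 2" for i j
    using A B that by (simp add: scalar_prod_def numeral_2_eq_2)
  then have "A $$ (i,0) * B $$ (0,j) + A $$ (i,1) * B $$ (1,j) = (if i = j then 1 else 0)"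
    if "i < 2" "j < 2" for i j
    using AB that by simp
  from this[of 0 0] this[of 0 1] this[of 1 0] this[of 1 1]
  have "A $$ (0,0) * B $$ (0,0) + A $$ (0,1) * B $$ (1,0) = 1"
    "A $$ (0,0) * B $$ (0,1) + A $$ (0,1) * B $$ (1,1) = 0"
    "A $$ (1,0) * B $$ (0,0) + A $$ (1,1) * B $$ (1,0) = 0"
    "A $$ (1,0) * B $$ (0,1) + A $$ (1,1) * B $$ (1,1) = 1"
    by simp_all
  moreover have "a * e + b * g = 1 \<Longrightarrow> a * f + b * h = 0 \<Longrightarrow> c * e + d * g = 0 \<Longrightarrow> c * f + d * h = 1
      \<Longrightarrow> (a * d - b * c) * (e * h - f * g) = 1" for a b c d e f g h :: "'a"
  proof -
    assume "a * e + b * g = 1" "a * f + b * h = 0" "c * e + d * g = 0" "c * f + d * h = 1"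
    moreover have "(a * d - b * c) * (e * h - f * g) =
        (a * e + b * g) * (c * f + d * h) - (a * f + b * h) * (c * e + d * g)"
      by (simp add: algebra_simps)
    ultimately show ?thesis by simp
  qed
  ultimately have "(A $$ (0,0) * A $$ (1,1) - A $$ (0,1) * A $$ (1,0)) *
      (B $$ (0,0) * B $$ (1,1) - B $$ (0,1) * B $$ (1,0)) = 1"
    by blast
  then show ?thesis by (metis dvd_triv_left)
qed

text \<open>
  With \<open>(a b; c d)\<close> the entries of \<open>A\<close>, the point \<open>(d, -c)\<close> is sent by \<open>A\<close> to \<open>(det A, 0)\<close>, where the form of
  \<open>g\<close> takes the value \<open>(det A)\<^sup>n\<close> times its leading coefficient, a unit. Passing from degree \<open>n\<close> to
  the degree of \<open>f\<close> only removes a factor \<open>(-c)\<^sup>k\<close>, and divisors of units are units.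
\<close>

lemma GL2_act_monic_unit_value:
  assumes "A \<in> GL2" "monic_in_y g" "f = GL2_act A g"
  obtains p q where "hom_eval (degree f) f p q dvd 1"
proof -
  let ?a = "A $$ (0,0)" and ?b = "A $$ (0,1)" and ?c = "A $$ (1,0)" and ?d = "A $$ (1,1)"
  let ?n = "degree g" and ?p = ?d and ?q = "- ?c"
  have le: "degree f \<le> ?n"
    using degree_GL2_act_le assms(3) by simp
  have "hom_eval ?n f ?p ?q = hom_eval ?n g (?a * ?d - ?b * ?c) 0"
    using hom_eval_GL2_act[of g A ?p ?q] assms(3) by (simp add: mult.commute)
  also have "\<dots> = lead_coeff g * (?a * ?d - ?b * ?c) ^ ?n"
  proof -
    have "hom_eval ?n g u 0 = (\<Sum>i\<in>{?n}. coeff g i * u ^ i * 0 ^ (?n - i))" for u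
      unfolding hom_eval_def by (rule sum.mono_neutral_right) auto
    then show ?thesis by simp
  qed
  also have "\<dots> dvd 1"
  proof -
    have "lead_coeff g dvd 1"
    proof -
      obtain k where "k \<noteq> 0" "lead_coeff g = [:k:]"
        using assms(2) by (auto simp: monic_in_y_def)
      then have "lead_coeff g * [:inverse k:] = 1"
        by simp
      then show ?thesis by (metis dvd_triv_left)
    qed
    moreover have "(?a * ?d - ?b * ?c) ^ ?n dvd 1"
      using dvd_power_same[OF GL2_det_unit[OF assms(1)], of ?n] by (simp only: power_one)
    ultimately show ?thesis
      by (simp only: is_unit_mult_iff)
  qed
  finally have "hom_eval ?n f ?p ?q dvd 1" .
  moreover have "hom_eval (degree f + k) f ?p ?q = ?q ^ k * hom_eval (degree f) f ?p ?q" for k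
    by (induction k) (simp_all add: hom_eval_Suc)
  from this[of "?n - degree f"] have "hom_eval (degree f) f ?p ?q dvd hom_eval ?n f ?p ?q"
    using le by simp
  ultimately show thesis
    using that dvd_trans by blast
qed

section \<open>The form of the quartic takes no nonzero constant value\<close>

lemma degree_add_eq_max:
  fixes p q :: "'a::comm_monoid_add poly"
  assumes "degree p \<noteq> degree q"
  shows "degree (p + q) = max (degree p) (degree q)"
proof (cases "degree p < degree q")
  case True
  then show ?thesis by (simp add: degree_add_eq_right)
next
  case False
  then have "degree q < degree p" using assms by simp
  then show ?thesis by (simp add: degree_add_eq_left)
qed

lemma quartic_form:
  fixes X L p q :: "'a::comm_ring_1"
  defines "w \<equiv> X * q\<^sup>2 - p\<^sup>2"
  shows "hom_eval 4 [:X ^ 3 + L\<^sup>2, - 2 * L * X, - 2 * X\<^sup>2, 2 * L, X:] p q =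
    X * w\<^sup>2 - 2 * L * p * q * w + L\<^sup>2 * q ^ 4"
  unfolding w_def hom_eval_def by (simp add: eval_nat_numeral algebra_simps)

text \<open>
  Since \<open>2 deg p\<close> and \<open>2 deg q\<close> are at most \<open>deg w\<close>, the last two terms have degree at most \<open>2 deg w\<close>, while
  the first has degree \<open>2 deg w + 1\<close>.
\<close>

lemma degree_quartic_form_pos:
  fixes p q :: "'a::field poly"
  assumes "p \<noteq> 0 \<or> q \<noteq> 0"
  defines "w \<equiv> [:0, 1:] * q\<^sup>2 - p\<^sup>2"
  shows "degree ([:0, 1:] * w\<^sup>2 - [:2 * l:] * p * q * w + [:l\<^sup>2:] * q ^ 4) > 0"
proof -
  have dq: "degree ([:0, 1:] * q\<^sup>2) = 2 * degree q + 1" if "q \<noteq> 0"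
    using that by (simp add: degree_mult_eq degree_power_eq)
  have dp: "degree (p\<^sup>2) = 2 * degree p"
    by (cases "p = 0") (simp_all add: degree_power_eq)
  have w: "w \<noteq> 0 \<and> 2 * degree p \<le> degree w \<and> 2 * degree q \<le> degree w"
  proof (cases "p = 0 \<or> q = 0")
    case True
    then show ?thesis
      using assms(1) dp dq by (auto simp: w_def)
  next
    case False
    \<comment> \<open>One of the two degrees is odd, the other is even.\<close>
    then have "degree ([:0, 1:] * q\<^sup>2) \<noteq> degree (p\<^sup>2)"
      using dp dq by presburger
    then have "degree w = max (degree ([:0, 1:] * q\<^sup>2)) (degree (p\<^sup>2))"
      using degree_add_eq_max[of "[:0, 1:] * q\<^sup>2" "- (p\<^sup>2)"]
      by (simp only: w_def diff_conv_add_uminus degree_minus simp_thms)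
    then show ?thesis
      using False dp dq by auto
  qed
  let ?A = "[:0, 1:] * w\<^sup>2" and ?B = "[:2 * l:] * p * q * w" and ?C = "[:l\<^sup>2:] * q ^ 4"
  have A: "degree ?A = 2 * degree w + 1"
    using w by (simp add: degree_mult_eq degree_power_eq)
  have "degree ?B \<le> degree p + degree q + degree w"
    using degree_mult_le[of "[:2 * l:] * p * q" w] degree_mult_le[of "[:2 * l:] * p" q]
      degree_mult_le[of "[:2 * l:]" p] by simp
  then have B: "degree ?B < degree ?A"
    using A w by linarith
  have "degree ?C \<le> 4 * degree q"
    using degree_mult_le[of "[:l\<^sup>2:]" "q ^ 4"] degree_power_le[of q 4] by simp
  then have C: "degree ?C < degree ?A"
    using A w by linarith
  have "degree (?A + (?C - ?B)) = degree ?A"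
    using B C by (intro degree_add_eq_left degree_diff_less)
  moreover have "?A - ?B + ?C = ?A + (?C - ?B)"
    by (simp only: diff_conv_add_uminus add.assoc add.commute[of "- ?B"])
  ultimately show ?thesis using A by (simp only:)
qed

section \<open>The polynomial \<open>f\<close> as a quartic in \<open>y\<close>\<close>

lemma quartic_coeffs:
  fixes lam :: "'a::field"
  shows "Xvar * (Xvar - Yvar ^ 2) ^ 2 - 2 * Const lam * Yvar * (Xvar - Yvar ^ 2) + Const lam ^ 2 =
    (let X = [:0, 1:]; L = [:lam:] in [:X ^ 3 + L\<^sup>2, - 2 * L * X, - 2 * X\<^sup>2, 2 * L, X:])"
  by (simp add: Let_def Xvar_def Yvar_def Const_def numeral_poly power2_eq_square power3_eq_cube)

lemma degree_discriminant_quartic: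
  fixes lam :: "'a::field_char_0"
  assumes "lam \<noteq> 0"
  shows "degree (discriminant
    [:[:0, 1:] ^ 3 + [:lam:]\<^sup>2, - 2 * [:lam:] * [:0, 1:], - 2 * [:0, 1:]\<^sup>2,
      2 * [:lam:], [:0, 1:]:]) = 3"
proof -
  \<comment> \<open>With \<open>X\<close> and \<open>L\<close> opaque the quartic formula collapses as an identity of commutative rings.\<close>
  define X L :: "'a poly" where "X = [:0, 1:]" and "L = [:lam:]"
  have "discriminant [:X ^ 3 + L\<^sup>2, - 2 * L * X, - 2 * X\<^sup>2, 2 * L, X:] =
      - (256 * L ^ 6 * X ^ 3 + 432 * L ^ 8)"
    by (subst discriminant_quartic) (simp add: X_def, simp add: algebra_simps power_numeral_reduce)
  also have "\<dots> = [:- 432 * lam ^ 8, 0, 0, - 256 * lam ^ 6:]"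
    by (simp add: X_def L_def poly_const_pow numeral_poly power3_eq_cube)
  finally show ?thesis
    using assms by (simp add: X_def L_def)
qed

theorem theorem1p5:
  fixes lam :: "'a::{alg_closed_field, field_char_0}"
    and f :: "'a poly poly"
  assumes "lam \<noteq> 0"
    and "f = Xvar * (Xvar - Yvar ^ 2) ^ 2 - 2 * Const lam * Yvar * (Xvar - Yvar ^ 2) + Const lam ^ 2"
  shows "minimal_polynomial f \<and> \<not> (\<exists>g. monic_in_y g \<and> G_equivalent f g)"
proof
  have f: "f = [:[:0, 1:] ^ 3 + [:lam:]\<^sup>2, - 2 * [:lam:] * [:0, 1:], - 2 * [:0, 1:]\<^sup>2,
      2 * [:lam:], [:0, 1:]:]"
    using assms(2) quartic_coeffs[of lam] by (simp only: Let_def)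
  have deg: "degree f = 4"
    unfolding f by simp
  show "minimal_polynomial f"
    using irreducible_quartic[OF assms(1)] degree_discriminant_quartic[OF assms(1)] deg
    unfolding minimal_polynomial_def f by simp
  show "\<not> (\<exists>g. monic_in_y g \<and> G_equivalent f g)"
  proof
    assume "\<exists>g. monic_in_y g \<and> G_equivalent f g"
    then obtain g A where "A \<in> GL2" "monic_in_y g" "f = GL2_act A g"
      unfolding G_equivalent_def by blast
    then obtain p q where "hom_eval (degree f) f p q dvd 1"
      by (rule GL2_act_monic_unit_value)
    then have unit: "hom_eval 4 f p q dvd 1"
      by (simp only: deg)
    have form: "hom_eval 4 f p q = [:0, 1:] * ([:0, 1:] * q\<^sup>2 - p\<^sup>2)\<^sup>2 -
        [:2 * lam:] * p * q * ([:0, 1:] * q\<^sup>2 - p\<^sup>2) + [:lam\<^sup>2:] * q ^ 4"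
    proof -
      have "2 * [:lam:] = [:2 * lam:]" "[:lam:]\<^sup>2 = [:lam\<^sup>2:]"
        by (simp_all add: numeral_poly power2_eq_square)
      then show ?thesis
        unfolding f quartic_form by (simp only:)
    qed
    have "p \<noteq> 0 \<or> q \<noteq> 0"
      using unit unfolding form by (cases "p = 0 \<and> q = 0") simp_all
    then have "degree (hom_eval 4 f p q) > 0"
      unfolding form by (rule degree_quartic_form_pos)
    then show False
      using unit by simp
  qed
qed

end
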